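(* Let $C\subseteq\mathbb{R}^\infty_{\ge0}$ be a $\mathrm{Sym}$-invariant cone. Then the dual cone $C^*=\{u\in\mathbb{R}^{\mathbb{N}}:\langle u,v\rangle\ge0\text{ for all } v\in C\}$ is not $\mathrm{Sym}$-equivariantly finitely generated, i.e. there is no finite set $A\subset\mathbb{R}^{\mathbb{N}}$ with $C^*=\mathrm{cn}(\mathrm{Sym}(A))$.
   Context: $\mathbb{R}^{\mathbb{N}}$ is the set of all real sequences and $\mathbb{R}^\infty\subseteq\mathbb{R}^{\mathbb{N}}$ the subset of sequences with finitely many nonzero entries; $\mathbb{R}^\infty_{\ge0}$ those with nonnegative entries. For $u\in\mathbb{R}^\infty$, $v\in\mathbb{R}^{\mathbb{N}}$, $\langle u,v\rangle=\sum_i u_iv_i$. $\mathrm{Sym}$ is the group of permutations of $\mathbb{N}$ fixing all but finitely many elements, acting by $\sigma(u)=(u_{\sigma^{-1}(1)},u_{\sigma^{-1}(2)},\dots)$; a set is $\mathrm{Sym}$-invariant if it is stable under this action; $\mathrm{Sym}(A)$ is the orbit set of $A$. $\mathrm{cn}(A)$ denotes the set of finite nonnegative real linear combinations of elements of $A$. *)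

theory Defs
  imports Complex_Main
begin

(* Real sequences are functions nat => real, indexed from 0 instead of from 1. *)

definition R_inf :: "(nat \<Rightarrow> real) set" where
  "R_inf = {u. finite {i. u i \<noteq> 0}}"

definition R_inf_nonneg :: "(nat \<Rightarrow> real) set" where
  "R_inf_nonneg = {u \<in> R_inf. \<forall>i. 0 \<le> u i}"

(* The sum is restricted to the nonzero terms. It is meaningful whenever at least one
   of the two sequences has finite support, whichever argument that is. *)
definition pairing :: "(nat \<Rightarrow> real) \<Rightarrow> (nat \<Rightarrow> real) \<Rightarrow> real" where
  "pairing u v = (\<Sum>i | u i * v i \<noteq> 0. u i * v i)"

definition Sym :: "(nat \<Rightarrow> nat) set" where
  "Sym = {\<sigma>. bij \<sigma> \<and> finite {i. \<sigma> i \<noteq> i}}"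

definition Sym_act :: "(nat \<Rightarrow> nat) \<Rightarrow> (nat \<Rightarrow> real) \<Rightarrow> (nat \<Rightarrow> real)" where
  "Sym_act \<sigma> u = (\<lambda>i. u (inv \<sigma> i))"

definition Sym_invariant :: "(nat \<Rightarrow> real) set \<Rightarrow> bool" where
  "Sym_invariant C \<longleftrightarrow> (\<forall>\<sigma>\<in>Sym. \<forall>u\<in>C. Sym_act \<sigma> u \<in> C)"

definition Sym_orbit :: "(nat \<Rightarrow> real) set \<Rightarrow> (nat \<Rightarrow> real) set" where
  "Sym_orbit A = {Sym_act \<sigma> a | \<sigma> a. \<sigma> \<in> Sym \<and> a \<in> A}"

(* The function space nat => real carries no real_vector instance, so the library's
   convex cones do not apply; linear combinations are written pointwise.
   The empty combination is included, so 0 lies in cn A for every A. *)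
definition cn :: "(nat \<Rightarrow> real) set \<Rightarrow> (nat \<Rightarrow> real) set" where
  "cn A = {(\<lambda>i. \<Sum>a\<in>F. c a * a i) | F c. finite F \<and> F \<subseteq> A \<and> (\<forall>a\<in>F. 0 \<le> c a)}"

(* A cone is a set closed under finite nonnegative linear combinations,
   i.e. a convex cone containing 0. *)
definition is_cone :: "(nat \<Rightarrow> real) set \<Rightarrow> bool" where
  "is_cone C \<longleftrightarrow> cn C = C"

definition dual_cone :: "(nat \<Rightarrow> real) set \<Rightarrow> (nat \<Rightarrow> real) set" where
  "dual_cone C = {u. \<forall>v\<in>C. 0 \<le> pairing u v}"

definition Sym_equivariantly_fin_gen :: "(nat \<Rightarrow> real) set \<Rightarrow> bool" where
  "Sym_equivariantly_fin_gen D \<longleftrightarrow> (\<exists>A. finite A \<and> D = cn (Sym_orbit A))"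

end

theory Submission
  imports Defs
begin

text \<open>
  A finitary permutation changes only finitely many entries of a sequence, so outside a finite
  set of indices every element of \<open>cn (Sym_orbit A)\<close> is bounded by a constant multiple of
  \<open>\<Sum>a\<in>A. \<bar>a i\<bar>\<close>. The dual cone contains all nonnegative sequences, in particular
  sequences that grow faster than any such multiple.
\<close>

lemma nonneg_in_dual_cone:
  assumes "C \<subseteq> R_inf_nonneg" and "\<And>i. 0 \<le> u i"
  shows "u \<in> dual_cone C"
  using assms by (auto simp: dual_cone_def pairing_def R_inf_nonneg_def intro!: sum_nonneg)

lemma eventually_Sym_act_eq:
  assumes "\<sigma> \<in> Sym"
  shows "\<forall>\<^sub>F i in sequentially. Sym_act \<sigma> u i = u i"
proof -
  have "bij \<sigma>" and fin: "finite {i. \<sigma> i \<noteq> i}"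
    using assms by (auto simp: Sym_def)
  \<comment> \<open>A point fixed by \<open>\<sigma>\<close> is also fixed by
    \<open>inv \<sigma>\<close>, so the entry there does not move.\<close>
  then have "{i. Sym_act \<sigma> u i \<noteq> u i} \<subseteq> {i. \<sigma> i \<noteq> i}"
    by (auto simp: Sym_act_def) (metis bij_inv_eq_iff)
  then have "finite {i. Sym_act \<sigma> u i \<noteq> u i}"
    using fin finite_subset by blast
  then show ?thesis
    by (simp add: cofinite_eq_sequentially [symmetric] eventually_cofinite)
qed

text \<open>Only \<open>K\<close> and the threshold depend on \<open>w\<close>; the comparison
  sequence depends on \<open>A\<close> alone, so a single sequence can outgrow the whole
  cone.\<close>

lemma cn_Sym_orbit_eventually_bounded:
  assumes "finite A" and "w \<in> cn (Sym_orbit A)"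
  shows "\<exists>K. \<forall>\<^sub>F i in sequentially. w i \<le> K * (\<Sum>a\<in>A. \<bar>a i\<bar>)"
proof -
  obtain F c where w: "w = (\<lambda>i. \<Sum>b\<in>F. c b * b i)" and "finite F"
    and F: "F \<subseteq> Sym_orbit A" and c: "\<And>b. b \<in> F \<Longrightarrow> 0 \<le> c b"
    using assms(2) by (auto simp: cn_def)
  have "\<forall>\<^sub>F i in sequentially. b i \<le> (\<Sum>a\<in>A. \<bar>a i\<bar>)" if "b \<in> F" for b
  proof -
    obtain \<sigma> a where b: "b = Sym_act \<sigma> a" "\<sigma> \<in> Sym" "a \<in> A"
      using F \<open>b \<in> F\<close> unfolding Sym_orbit_def by blast
    have le: "a i \<le> (\<Sum>a\<in>A. \<bar>a i\<bar>)" for i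
      using member_le_sum [of a A "\<lambda>a. \<bar>a i\<bar>"] b(3) assms(1) by auto
    show ?thesis
      using eventually_Sym_act_eq [OF b(2), of a] by eventually_elim (simp add: b(1) le)
  qed
  then have "\<forall>\<^sub>F i in sequentially. \<forall>b\<in>F. b i \<le> (\<Sum>a\<in>A. \<bar>a i\<bar>)"
    using \<open>finite F\<close> by (simp add: eventually_ball_finite)
  \<comment> \<open>\<open>K\<close> is the total weight of the combination; nonnegative weights
    preserve the termwise bounds.\<close>
  then have "\<forall>\<^sub>F i in sequentially. w i \<le> (\<Sum>b\<in>F. c b) * (\<Sum>a\<in>A. \<bar>a i\<bar>)"
    by eventually_elim (simp add: w sum_distrib_right sum_mono mult_left_mono c)
  then show ?thesis
    by blast
qed

theorem theorem4p9:
  fixes C :: "(nat \<Rightarrow> real) set"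
  assumes "C \<subseteq> R_inf_nonneg"
    and "is_cone C"
    and "Sym_invariant C"
  shows "\<not> Sym_equivariantly_fin_gen (dual_cone C)"
proof
  assume "Sym_equivariantly_fin_gen (dual_cone C)"
  then obtain A where A: "finite A" "dual_cone C = cn (Sym_orbit A)"
    by (auto simp: Sym_equivariantly_fin_gen_def)
  define S where "S i = (\<Sum>a\<in>A. \<bar>a i\<bar>)" for i :: nat
  have S: "0 \<le> S i" for i
    by (simp add: S_def sum_nonneg)
  \<comment> \<open>The factor \<open>real i\<close> beats every constant \<open>K\<close>; the
    summand 1 keeps the witness positive even where \<open>S\<close> vanishes.\<close>
  have "(\<lambda>i. real i * (1 + S i)) \<in> cn (Sym_orbit A)"
    using nonneg_in_dual_cone [OF assms(1)] S A(2) by simp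
  then obtain K where "\<forall>\<^sub>F i in sequentially. real i * (1 + S i) \<le> K * S i"
    using cn_Sym_orbit_eventually_bounded [OF A(1)] unfolding S_def by blast
  \<comment> \<open>From \<open>K\<close> \<le> i follows \<open>K * S i\<close> \<le>
    \<open>real i * S i\<close>; from 1 \<le> i, the remaining term \<open>real i\<close> makes the
    inequality strict.\<close>
  moreover have "\<forall>\<^sub>F i in sequentially. max K 1 \<le> real i"
    using filterlim_real_sequentially unfolding filterlim_at_top by blast
  ultimately have "\<forall>\<^sub>F i :: nat in sequentially. False"
  proof eventually_elim
    case (elim i)
    then have "K * S i \<le> real i * S i" and "1 \<le> real i"
      using S by (auto intro: mult_right_mono)
    with elim show False
      by (simp add: distrib_left)
  qed
  then show False
    by simp
qed

end
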